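(* Let $\lambda\ge0$, $T>0$, and let $\gamma\colon[0,T)\times\mathbb{S}^1\to\mathbb{R}^2$ be a sufficiently smooth family of regular closed curves solving $$\partial_t^\perp\gamma=\nabla_s^2\Big(\nabla_s^2\kappa+\tfrac12|\kappa|^2\kappa-\lambda\kappa\Big).$$ Then $$\frac{\mathrm{d}}{\mathrm{d}t}\mathcal{A}(\gamma)=0 .$$
   Context: For a regular curve $\gamma\colon\mathbb{S}^1\to\mathbb{R}^2$ ($\partial_x\gamma\ne0$): $\partial_s=|\partial_x\gamma|^{-1}\partial_x$, $\mathrm{d}s=|\partial_x\gamma|\,\mathrm{d}x$, $\kappa=\partial_s^2\gamma$ is the curvature vector, $\nu$ is the counter-clockwise rotation of $\partial_s\gamma$ by $\pi/2$. For a vector field $\phi$ along $\gamma$, $P^\perp\phi=\phi-\langle\phi,\partial_s\gamma\rangle\partial_s\gamma$, $\nabla_s=P^\perp\partial_s$, $\partial_t^\perp=P^\perp\partial_t$; for time-dependent $\gamma$ these are taken for each $\gamma(t,\cdot)$. The signed enclosed area is $\mathcal{A}(\gamma)=-\frac12\int_{\mathbb{S}^1}\langle\gamma,\nu\rangle\,\mathrm{d}s$. "Sufficiently smooth" means of class $C^k$ jointly in $(t,x)$ for some sufficiently large $k$. Only the normal velocity is prescribed; the tangential velocity $\langle\partial_t\gamma,\partial_s\gamma\rangle$ is arbitrary. *)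

theory Defs
  imports "HOL-Analysis.Analysis"
begin

(* The circle is R / (2 pi Z): a closed curve is a 2 pi-periodic map c :: real => real^2, and a
   vector field along c is a map phi :: real => real^2. *)

definition closed_curve :: "(real \<Rightarrow> real^2) \<Rightarrow> bool" where
  "closed_curve c \<longleftrightarrow> (\<forall>x. c (x + 2 * pi) = c x)"

abbreviation d_x :: "(real \<Rightarrow> real^2) \<Rightarrow> real \<Rightarrow> real^2" where
  "d_x \<phi> x \<equiv> vector_derivative \<phi> (at x)"

definition regular_curve :: "(real \<Rightarrow> real^2) \<Rightarrow> bool" where
  "regular_curve c \<longleftrightarrow> (\<forall>x. d_x c x \<noteq> 0)"

definition d_s :: "(real \<Rightarrow> real^2) \<Rightarrow> (real \<Rightarrow> real^2) \<Rightarrow> real \<Rightarrow> real^2" where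
  "d_s c \<phi> x = (1 / norm (d_x c x)) *\<^sub>R d_x \<phi> x"

definition curvature_vec :: "(real \<Rightarrow> real^2) \<Rightarrow> real \<Rightarrow> real^2" where
  "curvature_vec c = d_s c (d_s c c)"

definition rot90 :: "real^2 \<Rightarrow> real^2" where
  "rot90 v = vector [- (v $ 2), v $ 1]"

definition unit_normal :: "(real \<Rightarrow> real^2) \<Rightarrow> real \<Rightarrow> real^2" where
  "unit_normal c x = rot90 (d_s c c x)"

definition P_perp :: "(real \<Rightarrow> real^2) \<Rightarrow> (real \<Rightarrow> real^2) \<Rightarrow> real \<Rightarrow> real^2" where
  "P_perp c \<phi> x = \<phi> x - (\<phi> x \<bullet> d_s c c x) *\<^sub>R d_s c c x"

definition nabla_s :: "(real \<Rightarrow> real^2) \<Rightarrow> (real \<Rightarrow> real^2) \<Rightarrow> real \<Rightarrow> real^2" where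
  "nabla_s c \<phi> = P_perp c (d_s c \<phi>)"

definition enclosed_area :: "(real \<Rightarrow> real^2) \<Rightarrow> real" where
  "enclosed_area c =
     - (1/2) * integral {0..2 * pi} (\<lambda>x. (c x \<bullet> unit_normal c x) * norm (d_x c x))"

(* Time derivatives are taken within [0,T), hence one-sided at t = 0. *)

definition d_t :: "real \<Rightarrow> (real \<Rightarrow> real \<Rightarrow> real^2) \<Rightarrow> real \<Rightarrow> real \<Rightarrow> real^2" where
  "d_t T \<gamma> t x = vector_derivative (\<lambda>\<tau>. \<gamma> \<tau> x) (at t within {0..<T})"

definition d_t_perp :: "real \<Rightarrow> (real \<Rightarrow> real \<Rightarrow> real^2) \<Rightarrow> real \<Rightarrow> real \<Rightarrow> real^2" where
  "d_t_perp T \<gamma> t = P_perp (\<gamma> t) (d_t T \<gamma> t)"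

(* Class C^k jointly in (t,x) on [0,T) x R: all iterated (possibly mixed) partial derivatives
   of total order at most k exist and are jointly continuous. *)

primrec C_k_joint :: "nat \<Rightarrow> real \<Rightarrow> (real \<Rightarrow> real \<Rightarrow> real^2) \<Rightarrow> bool" where
  "C_k_joint 0 T f \<longleftrightarrow> continuous_on ({0..<T} \<times> UNIV) (\<lambda>(t, x). f t x)"
| "C_k_joint (Suc k) T f \<longleftrightarrow>
     continuous_on ({0..<T} \<times> UNIV) (\<lambda>(t, x). f t x) \<and>
     (\<exists>ft fx.
        (\<forall>t\<in>{0..<T}. \<forall>x.
           ((\<lambda>\<tau>. f \<tau> x) has_vector_derivative ft t x) (at t within {0..<T}) \<and>
           (f t has_vector_derivative fx t x) (at x)) \<and>
        C_k_joint k T ft \<and> C_k_joint k T fx)"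

definition flow_rhs :: "real \<Rightarrow> (real \<Rightarrow> real^2) \<Rightarrow> real \<Rightarrow> real^2" where
  "flow_rhs lam c =
     (nabla_s c ^^ 2)
       (\<lambda>x. (nabla_s c ^^ 2) (curvature_vec c) x
          + ((1/2) * (norm (curvature_vec c x))\<^sup>2) *\<^sub>R curvature_vec c x
          - lam *\<^sub>R curvature_vec c x)"

end

theory Submission
  imports Defs
begin

text \<open>Since \<open>\<nu> |\<gamma>\<^sub>x|\<close> is the rotated tangent \<open>R \<gamma>\<^sub>x\<close>, the time derivative of
  \<open>\<langle>\<gamma>, R \<gamma>\<^sub>x\<rangle>\<close> equals \<open>2 \<langle>\<gamma>\<^sub>t, R \<gamma>\<^sub>x\<rangle>\<close> plus the \<open>x\<close>-derivative of \<open>\<langle>\<gamma>, R \<gamma>\<^sub>t\<rangle>\<close>.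
  The flow equation turns \<open>\<langle>\<gamma>\<^sub>t, R \<gamma>\<^sub>x\<rangle>\<close> into \<open>\<langle>\<nabla>\<^sub>s \<Phi>, \<nu>\<rangle> |\<gamma>\<^sub>x|\<close> with
  a normal field \<open>\<Phi>\<close>, and this is the \<open>x\<close>-derivative of \<open>\<langle>\<Phi>, \<nu>\<rangle>\<close> because \<open>\<partial>\<^sub>s \<nu>\<close> is tangential.
  So the integrand is the derivative of a periodic function. Only the divergence form
  \<open>\<nabla>\<^sub>s \<Phi>\<close> of the right-hand side matters.\<close>

section \<open>Iterated differentiability\<close>

text \<open>A derivative function is exhibited at each level, so closure under sums and products
  follows by induction from the differentiation rules. The highest derivative may be
  discontinuous.\<close>

primrec times_diff :: "nat \<Rightarrow> (real \<Rightarrow> 'a::real_normed_vector) \<Rightarrow> bool" where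
  "times_diff 0 f \<longleftrightarrow> True"
| "times_diff (Suc n) f \<longleftrightarrow>
     (\<exists>f'. (\<forall>x. (f has_vector_derivative f' x) (at x)) \<and> times_diff n f')"

lemma times_diff_SucD: "times_diff (Suc n) f \<Longrightarrow> times_diff n f"
proof (induction n arbitrary: f)
  case (Suc n)
  then obtain f' where "\<forall>x. (f has_vector_derivative f' x) (at x)" "times_diff (Suc n) f'"
    by auto
  with Suc.IH[of f'] show ?case by auto
qed simp

lemma times_diff_le:
  assumes "times_diff m f" "n \<le> m"
  shows "times_diff n f"
  using assms(2,1) by (induction n rule: inc_induct)
    (auto dest: times_diff_SucD simp del: times_diff.simps)

lemma times_diff_d_x: "times_diff (Suc n) f \<Longrightarrow> times_diff n (d_x f)"
proof -
  assume "times_diff (Suc n) f"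
  then obtain f' where f': "\<And>x. (f has_vector_derivative f' x) (at x)" "times_diff n f'"
    by auto
  then have "d_x f = f'" by (auto simp: vector_derivative_at)
  with f' show ?thesis by simp
qed

lemma times_diff_has_vector_derivative:
  "times_diff (Suc n) f \<Longrightarrow> (f has_vector_derivative vector_derivative f (at x)) (at x)"
  by (auto intro: vector_derivative_works[THEN iffD1] differentiableI_vector)

lemma times_diff_const: "times_diff n (\<lambda>x. c)"
  by (induction n arbitrary: c) (auto intro!: exI[of _ "\<lambda>x. 0"])

lemma times_diff_add:
  "times_diff n f \<Longrightarrow> times_diff n g \<Longrightarrow> times_diff n (\<lambda>x. f x + g x)"
proof (induction n arbitrary: f g)
  case (Suc n)
  then obtain f' g' where "\<And>x. (f has_vector_derivative f' x) (at x)" "times_diff n f'"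
    "\<And>x. (g has_vector_derivative g' x) (at x)" "times_diff n g'"
    by auto
  with Suc.IH show ?case
    by (auto intro!: exI[of _ "\<lambda>x. f' x + g' x"] has_vector_derivative_add)
qed simp

text \<open>Stated for any bounded bilinear map so that scaling, multiplication and the inner
  product are all instances.\<close>

lemma (in bounded_bilinear) times_diff:
  "times_diff n f \<Longrightarrow> times_diff n g \<Longrightarrow> times_diff n (\<lambda>x. prod (f x) (g x))"
proof (induction n arbitrary: f g)
  case (Suc n)
  then obtain f' g' where "\<And>x. (f has_vector_derivative f' x) (at x)" "times_diff n f'"
    "\<And>x. (g has_vector_derivative g' x) (at x)" "times_diff n g'"
    by auto
  moreover have "times_diff n f" "times_diff n g"
    using Suc.prems by (simp_all only: times_diff_SucD)
  ultimately show ?case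
    using Suc.IH
    by (auto intro!: exI[of _ "\<lambda>x. prod (f x) (g' x) + prod (f' x) (g x)"]
      has_vector_derivative times_diff_add)
qed simp

lemmas times_diff_scaleR = bounded_bilinear.times_diff[OF bounded_bilinear_scaleR]
lemmas times_diff_mult = bounded_bilinear.times_diff[OF bounded_bilinear_mult]
lemmas times_diff_inner = bounded_bilinear.times_diff[OF bounded_bilinear_inner]

lemma times_diff_diff:
  assumes "times_diff n f" "times_diff n g"
  shows "times_diff n (\<lambda>x. f x - g x)"
  using times_diff_add[OF assms(1) times_diff_scaleR[OF times_diff_const[of n "-1"] assms(2)]]
  by simp

text \<open>The cube of \<open>1 / norm (v x)\<close> is spelled out as a product: the derivative is
  then built from \<open>v\<close>, \<open>v'\<close> and the function itself, which lets the
  induction in \<open>times_diff_inverse_norm\<close> close.\<close>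

lemma inverse_norm_has_vector_derivative:
  fixes v :: "real \<Rightarrow> 'a::real_inner"
  assumes v: "(v has_vector_derivative v') (at x)" and nz: "v x \<noteq> 0"
  shows "((\<lambda>x. 1 / norm (v x)) has_vector_derivative
           - (v x \<bullet> v') * ((1 / norm (v x)) * ((1 / norm (v x)) * (1 / norm (v x))))) (at x)"
proof -
  have "((\<lambda>x. v x \<bullet> v x) has_real_derivative v x \<bullet> v' + v' \<bullet> v x) (at x)"
    using bounded_bilinear.has_vector_derivative[OF bounded_bilinear_inner v v]
    by (simp add: has_real_derivative_iff_has_vector_derivative)
  moreover have "v x \<bullet> v x > 0" using nz by simp
  ultimately have "((\<lambda>x. 1 / sqrt (v x \<bullet> v x)) has_real_derivative
      - (v x \<bullet> v') * ((1 / norm (v x)) * ((1 / norm (v x)) * (1 / norm (v x))))) (at x)"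
    by (auto intro!: derivative_eq_intros simp: norm_eq_sqrt_inner inner_commute field_simps
        inner_ge_zero[THEN leD])
  then show ?thesis
    by (simp add: has_real_derivative_iff_has_vector_derivative norm_eq_sqrt_inner)
qed

lemma times_diff_inverse_norm:
  fixes v :: "real \<Rightarrow> 'a::real_inner"
  assumes "\<And>x. v x \<noteq> 0"
  shows "times_diff n v \<Longrightarrow> times_diff n (\<lambda>x. 1 / norm (v x))"
proof (induction n)
  case (Suc n)
  then obtain v' where v': "\<And>x. (v has_vector_derivative v' x) (at x)" "times_diff n v'"
    by auto
  have v: "times_diff n v" using Suc.prems by (rule times_diff_SucD)
  let ?h = "\<lambda>x. 1 / norm (v x)"
  have h: "times_diff n ?h" using Suc.IH[OF v] .
  have "times_diff n (\<lambda>x. - 1 * (v x \<bullet> v' x) * (?h x * (?h x * ?h x)))"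
    by (intro times_diff_mult times_diff_inner times_diff_const h v v')
  then show ?case
    using inverse_norm_has_vector_derivative[OF v'(1) assms]
    by (auto intro!: exI[of _ "\<lambda>x. - (v x \<bullet> v' x) * (?h x * (?h x * ?h x))"])
qed simp

section \<open>Regularity and periodicity of the geometric quantities\<close>

context
  fixes c :: "real \<Rightarrow> real^2"
  assumes regular: "regular_curve c"
begin

lemma times_diff_d_s:
  assumes "times_diff (Suc n) c" "times_diff (Suc n) \<phi>"
  shows "times_diff n (d_s c \<phi>)"
  unfolding d_s_def using regular
  by (intro times_diff_scaleR times_diff_inverse_norm times_diff_d_x assms)
    (simp add: regular_curve_def)

lemma times_diff_nabla_s:
  assumes "times_diff (Suc n) c" "times_diff (Suc n) \<phi>"
  shows "times_diff n (nabla_s c \<phi>)"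
  unfolding nabla_s_def P_perp_def
  by (intro times_diff_scaleR times_diff_inner times_diff_diff times_diff_d_s assms)

lemma times_diff_curvature_vec:
  assumes "times_diff (Suc (Suc n)) c"
  shows "times_diff n (curvature_vec c)"
  unfolding curvature_vec_def
  by (intro times_diff_d_s assms times_diff_SucD[OF assms])

lemma norm_tangent: "d_s c c x \<bullet> d_s c c x = 1"
  using regular by (simp add: d_s_def regular_curve_def dot_square_norm power2_eq_square)

lemma nabla_s_normal: "nabla_s c \<phi> x \<bullet> d_s c c x = 0"
  by (simp add: nabla_s_def P_perp_def inner_diff_left norm_tangent)

end

text \<open>Differentiability is not assumed. The candidates \<open>D\<close> for the derivative at
  \<open>x\<close> and at \<open>x + 2 * pi\<close> form the same set, so the choice made by
  \<open>vector_derivative\<close> agrees even where no derivative exists.\<close>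

lemma closed_curve_d_x: "closed_curve \<phi> \<Longrightarrow> closed_curve (d_x \<phi>)"
proof -
  assume "closed_curve \<phi>"
  then have period: "\<phi> (x + 2 * pi) = \<phi> x" for x by (simp add: closed_curve_def)
  have shift: "(\<phi> has_vector_derivative D) (at x)"
    if "\<And>y. \<phi> (y + p) = \<phi> y" "(\<phi> has_vector_derivative D) (at (x + p))" for x D p
  proof -
    have "((\<lambda>y. y + p) has_vector_derivative 1) (at x)"
      by (auto intro!: derivative_eq_intros)
    from vector_diff_chain_at[OF this that(2)] show ?thesis
      using that(1) by (simp add: o_def)
  qed
  have "(\<phi> has_vector_derivative D) (at (x + 2 * pi)) \<longleftrightarrow> (\<phi> has_vector_derivative D) (at x)"
    for x D
    using shift[of "2 * pi" D x] shift[of "- (2 * pi)" D "x + 2 * pi"] period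
      period[of "y - 2 * pi" for y] by auto
  then show ?thesis by (simp add: closed_curve_def vector_derivative_def)
qed

lemma closed_curve_d_s: "closed_curve c \<Longrightarrow> closed_curve \<phi> \<Longrightarrow> closed_curve (d_s c \<phi>)"
  using closed_curve_d_x[of c] closed_curve_d_x[of \<phi>] by (simp add: closed_curve_def d_s_def)

lemma closed_curve_nabla_s:
  "closed_curve c \<Longrightarrow> closed_curve \<phi> \<Longrightarrow> closed_curve (nabla_s c \<phi>)"
  using closed_curve_d_s[of c c] closed_curve_d_s[of c \<phi>]
  by (simp add: closed_curve_def nabla_s_def P_perp_def)

lemma closed_curve_curvature_vec: "closed_curve c \<Longrightarrow> closed_curve (curvature_vec c)"
  by (simp add: curvature_vec_def closed_curve_d_s)

section \<open>Rotation and the normal component\<close>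

lemma rot90_nth [simp]: "rot90 v $ 1 = - (v $ 2)" "rot90 v $ 2 = v $ 1"
  by (simp_all add: rot90_def)

lemma bounded_linear_rot90: "bounded_linear rot90"
  by (rule linear_conv_bounded_linear[THEN iffD1], rule linearI)
    (simp_all add: vec_eq_iff forall_2)

lemma inner_2: "(u :: real^2) \<bullet> v = u $ 1 * v $ 1 + u $ 2 * v $ 2"
  by (simp add: inner_vec_def sum_2)

lemma inner_rot90_skew: "u \<bullet> rot90 v = - (rot90 u \<bullet> v)"
  by (simp add: inner_2)

text \<open>In the plane, two vectors orthogonal to the same unit vector are parallel, so a quarter
  turn of one is orthogonal to the other.\<close>

lemma inner_rot90_eq_0:
  assumes "u \<bullet> e = 0" "v \<bullet> e = 0" "e \<bullet> e = 1"
  shows "u \<bullet> rot90 v = 0"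
proof -
  have "u \<bullet> rot90 v = (u \<bullet> rot90 v) * (e \<bullet> e)" using assms by simp
  also have "\<dots> = (u \<bullet> e) * (e \<bullet> rot90 v) - (v \<bullet> e) * (e \<bullet> rot90 u)"
    by (simp add: inner_2 algebra_simps)
  finally show ?thesis using assms by simp
qed

lemma rot90_scaleR: "rot90 (a *\<^sub>R v) = a *\<^sub>R rot90 v"
  by (simp add: vec_eq_iff forall_2)

text \<open>The speed cancels the normalisation of the tangent. The area integrand thereby becomes
  bilinear in the curve and its tangent, and no norm has to be differentiated in time.\<close>

lemma unit_normal_speed:
  "regular_curve c \<Longrightarrow> norm (d_x c x) *\<^sub>R unit_normal c x = rot90 (d_x c x)"
  by (simp add: unit_normal_def d_s_def rot90_scaleR regular_curve_def)

text \<open>The part removed by the projection is a multiple of the tangent, which is orthogonal to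
  its own rotation. This discards the tangential velocity and also strips the projection from
  \<open>nabla_s\<close>.\<close>

lemma P_perp_unit_normal: "P_perp c \<phi> x \<bullet> unit_normal c x = \<phi> x \<bullet> unit_normal c x"
  by (simp add: P_perp_def unit_normal_def inner_2 algebra_simps)

lemma normal_component_has_derivative:
  assumes c: "regular_curve c" "times_diff 2 c" and \<Phi>: "times_diff 1 \<Phi>"
    and normal: "\<And>x. \<Phi> x \<bullet> d_s c c x = 0"
  shows "((\<lambda>x. \<Phi> x \<bullet> unit_normal c x) has_vector_derivative
           (nabla_s c \<Phi> x \<bullet> unit_normal c x) * norm (d_x c x)) (at x)"
proof -
  let ?e = "d_s c c"
  have "times_diff (Suc 0) ?e"
    using c by (intro times_diff_d_s) (simp_all add: numeral_2_eq_2 del: times_diff.simps)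
  then have e: "(?e has_vector_derivative d_x ?e x) (at x)"
    by (rule times_diff_has_vector_derivative)
  have \<Phi>': "(\<Phi> has_vector_derivative d_x \<Phi> x) (at x)"
    using \<Phi> times_diff_has_vector_derivative[of 0 \<Phi>] by simp
  have "((\<lambda>x. ?e x \<bullet> ?e x) has_vector_derivative ?e x \<bullet> d_x ?e x + d_x ?e x \<bullet> ?e x) (at x)"
    by (rule bounded_bilinear.has_vector_derivative[OF bounded_bilinear_inner e e])
  moreover have "((\<lambda>x. ?e x \<bullet> ?e x) has_vector_derivative 0) (at x)"
    using norm_tangent[OF c(1)] by simp
  ultimately have "d_x ?e x \<bullet> ?e x = 0"
    using vector_derivative_unique_at by (fastforce simp: inner_commute)
  \<comment> \<open>Both \<open>\<Phi>\<close> and the derivative of the unit tangent are orthogonal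
    to the tangent, so the product-rule term that differentiates the normal vanishes.\<close>
  then have "\<Phi> x \<bullet> rot90 (d_x ?e x) = 0"
    using normal norm_tangent[OF c(1)] by (intro inner_rot90_eq_0)
  moreover have "((\<lambda>x. \<Phi> x \<bullet> rot90 (?e x)) has_vector_derivative
      \<Phi> x \<bullet> rot90 (d_x ?e x) + d_x \<Phi> x \<bullet> rot90 (?e x)) (at x)"
    by (intro bounded_bilinear.has_vector_derivative[OF bounded_bilinear_inner] \<Phi>'
        bounded_linear.has_vector_derivative[OF bounded_linear_rot90 e])
  \<comment> \<open>The projection in \<open>nabla_s\<close> is invisible to the normal, and the
    speed turns \<open>d_s\<close> back into \<open>d_x\<close>.\<close>
  moreover have "d_x \<Phi> x \<bullet> rot90 (?e x) = (nabla_s c \<Phi> x \<bullet> unit_normal c x) * norm (d_x c x)"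
    using c(1) unfolding nabla_s_def P_perp_unit_normal
    by (simp add: d_s_def[of c \<Phi>] unit_normal_def regular_curve_def)
  ultimately show ?thesis by (simp add: unit_normal_def)
qed

text \<open>Take \<open>G\<close> to be the normal component of \<open>\<Phi>\<close>. Of six
  derivatives of \<open>c\<close>, the curvature leaves four, \<open>W\<close> two and
  \<open>\<Phi>\<close> one, which is spent on differentiating \<open>G\<close>.\<close>

lemma flow_rhs_normal_antiderivative:
  assumes c: "closed_curve c" "regular_curve c" "times_diff 6 c"
  obtains G where
    "\<And>x. (G has_vector_derivative (flow_rhs lam c x \<bullet> unit_normal c x) * norm (d_x c x)) (at x)"
    "\<And>x. G (x + 2 * pi) = G x"
proof -
  define W where "W = (\<lambda>x. (nabla_s c ^^ 2) (curvature_vec c) x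
          + ((1/2) * (norm (curvature_vec c x))\<^sup>2) *\<^sub>R curvature_vec c x
          - lam *\<^sub>R curvature_vec c x)"
  \<comment> \<open>The inner one of the two outermost \<open>nabla_s\<close> is absorbed here,
    which makes \<open>\<Phi>\<close> normal; the other one supplies the divergence form.\<close>
  define \<Phi> where "\<Phi> = nabla_s c W"
  have td: "times_diff n c" if "n \<le> 6" for n
    using c(3) that by (rule times_diff_le)
  have nab: "times_diff n (nabla_s c \<phi>)" if "n \<le> 5" "times_diff (Suc n) \<phi>" for n \<phi>
    using that by (intro times_diff_nabla_s c td) auto
  have \<kappa>: "times_diff n (curvature_vec c)" if "n \<le> 4" for n
    using that by (intro times_diff_curvature_vec c td) auto
  have "times_diff 2 ((nabla_s c ^^ 2) (curvature_vec c))"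
    using nab[OF _ nab[OF _ \<kappa>], of 2] by (simp add: eval_nat_numeral del: times_diff.simps)
  then have "times_diff 2 W"
    unfolding W_def power2_norm_eq_inner
    by (intro times_diff_add times_diff_diff times_diff_scaleR times_diff_mult times_diff_const
        times_diff_inner \<kappa>) auto
  then have "times_diff 1 \<Phi>"
    unfolding \<Phi>_def by (intro nab) (simp_all add: numeral_2_eq_2 del: times_diff.simps)
  then have "((\<lambda>x. \<Phi> x \<bullet> unit_normal c x) has_vector_derivative
           (nabla_s c \<Phi> x \<bullet> unit_normal c x) * norm (d_x c x)) (at x)" for x
    by (intro normal_component_has_derivative c td) (auto simp: \<Phi>_def nabla_s_normal c)
  moreover have "flow_rhs lam c = nabla_s c \<Phi>"
    by (simp add: flow_rhs_def \<Phi>_def W_def eval_nat_numeral)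
  moreover have "closed_curve \<Phi>"
  proof -
    have "closed_curve ((nabla_s c ^^ 2) (curvature_vec c))"
      by (simp add: eval_nat_numeral closed_curve_nabla_s closed_curve_curvature_vec c)
    then have "closed_curve W"
      using closed_curve_curvature_vec[OF c(1)] by (simp add: closed_curve_def W_def)
    then show ?thesis by (simp add: \<Phi>_def closed_curve_nabla_s c)
  qed
  ultimately show ?thesis
    using that[of "\<lambda>x. \<Phi> x \<bullet> unit_normal c x"] closed_curve_d_s[OF c(1) c(1)]
    by (simp add: closed_curve_def unit_normal_def)
qed

section \<open>Joint regularity in time and space\<close>

lemma C_k_joint_times_diff: "C_k_joint k T f \<Longrightarrow> t \<in> {0..<T} \<Longrightarrow> times_diff k (f t)"
proof (induction k arbitrary: f)
  case (Suc k)
  then obtain fx where "\<forall>x. (f t has_vector_derivative fx t x) (at x)" "C_k_joint k T fx"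
    by fastforce
  with Suc show ?case by (auto intro!: exI[of _ "fx t"])
qed simp

text \<open>This gives uniqueness of derivatives within the time interval, including the one-sided
  derivative at time 0.\<close>

lemma at_within_time_ne_bot:
  assumes "t \<in> {0..<T::real}"
  shows "at t within {0..<T} \<noteq> bot"
proof -
  have "t islimpt {0..<T}"
    using assms islimpt_subset[OF islimpt_greaterThanLessThan1[of t T]] by force
  then show ?thesis by (simp add: trivial_limit_within)
qed

lemma continuous_on_slice:
  assumes "continuous_on (A \<times> UNIV) (\<lambda>(t, x). f t x)" "t \<in> A"
  shows "continuous_on S (f t)"
proof -
  have "continuous_on S ((\<lambda>(t, x). f t x) \<circ> Pair t)"
    using assms(2)
    by (intro continuous_on_compose continuous_on_subset[OF assms(1)] continuous_intros) auto
  then show ?thesis by (simp add: o_def)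
qed

text \<open>Symmetry of the mixed partial derivatives, valid up to the boundary time: differentiate
  \<open>\<integral>\<^sub>a\<^sup>x f\<^sub>x = f(\<cdot>, x) - f(\<cdot>, a)\<close> first in time and then in \<open>x\<close>.\<close>

lemma mixed_partials_commute:
  fixes f :: "real \<Rightarrow> real \<Rightarrow> 'a::euclidean_space"
  assumes ft: "\<And>t x. t \<in> {0..<T} \<Longrightarrow> ((\<lambda>\<tau>. f \<tau> x) has_vector_derivative ft t x) (at t within {0..<T})"
    and fx: "\<And>t x. t \<in> {0..<T} \<Longrightarrow> (f t has_vector_derivative fx t x) (at x)"
    and fxt: "\<And>t x. t \<in> {0..<T} \<Longrightarrow> ((\<lambda>\<tau>. fx \<tau> x) has_vector_derivative fxt t x) (at t within {0..<T})"
    and cont: "continuous_on ({0..<T} \<times> UNIV) (\<lambda>(t, x). fxt t x)"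
    and t: "t \<in> {0..<T}"
  shows "(ft t has_vector_derivative fxt t x) (at x)"
proof -
  \<comment> \<open>Any base point strictly left of \<open>x\<close> would do: \<open>x\<close> is
    then interior to the interval \<open>{a..x+1}\<close>, and the derivative within it is
    two-sided.\<close>
  define a where "a = x - 1"
  have int_fx: "(fx \<tau> has_integral f \<tau> y - f \<tau> a) {a..y}" if "\<tau> \<in> {0..<T}" "a \<le> y" for \<tau> y
    using that fx
    by (intro fundamental_theorem_of_calculus) (auto intro: has_vector_derivative_at_within)
  have *: "integral {a..y} (fxt t) = ft t y - ft t a" if "a \<le> y" for y
  proof -
    have "((\<lambda>\<tau>. integral (cbox a y) (fx \<tau>)) has_vector_derivative integral (cbox a y) (fxt t))
        (at t within {0..<T})"
      using int_fx[OF _ that] t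
      by (intro leibniz_rule_vector_derivative[OF fxt _ continuous_on_subset[OF cont]])
        (auto simp: integrable_on_def)
    moreover have "((\<lambda>\<tau>. f \<tau> y - f \<tau> a) has_vector_derivative ft t y - ft t a) (at t within {0..<T})"
      using ft t by (intro has_vector_derivative_diff)
    then have "((\<lambda>\<tau>. integral (cbox a y) (fx \<tau>)) has_vector_derivative ft t y - ft t a)
        (at t within {0..<T})"
      by (rule has_vector_derivative_transform[OF t, rotated])
        (use integral_unique[OF int_fx] that in auto)
    ultimately show ?thesis
      using vector_derivative_unique_within[OF at_within_time_ne_bot[OF t]] by fastforce
  qed
  have "((\<lambda>y. integral {a..y} (fxt t)) has_vector_derivative fxt t x) (at x within {a..x+1})"
    using continuous_on_slice[OF cont t]
    by (intro integral_has_vector_derivative) (auto simp: a_def)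
  then have "((\<lambda>y. ft t y - ft t a) has_vector_derivative fxt t x) (at x within {a..x+1})"
    by (rule has_vector_derivative_transform[rotated 2]) (use * in \<open>auto simp: a_def\<close>)
  then have "((\<lambda>y. (ft t y - ft t a) + ft t a) has_vector_derivative fxt t x + 0)
      (at x within {a..x+1})"
    by (intro has_vector_derivative_add has_vector_derivative_const)
  moreover have "at x within {a..x+1} = at x"
    by (intro at_within_interior) (simp add: a_def)
  ultimately show ?thesis by simp
qed

section \<open>Time derivative of the enclosed area\<close>

lemma enclosed_area_rot90:
  "regular_curve c \<Longrightarrow>
    enclosed_area c = - (1/2) * integral {0..2 * pi} (\<lambda>x. c x \<bullet> rot90 (d_x c x))"
  by (simp add: enclosed_area_def unit_normal_speed[symmetric] mult.commute)

theorem lemma3p5: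
  shows "\<exists>k::nat. \<forall>(lam::real) (T::real) (\<gamma> :: real \<Rightarrow> real \<Rightarrow> real^2).
    lam \<ge> 0 \<longrightarrow> T > 0 \<longrightarrow>
    C_k_joint k T \<gamma> \<longrightarrow>
    (\<forall>t\<in>{0..<T}. closed_curve (\<gamma> t) \<and> regular_curve (\<gamma> t)) \<longrightarrow>
    (\<forall>t\<in>{0..<T}. \<forall>x. d_t_perp T \<gamma> t x = flow_rhs lam (\<gamma> t) x) \<longrightarrow>
    (\<forall>t\<in>{0..<T}.
       ((\<lambda>\<tau>. enclosed_area (\<gamma> \<tau>)) has_real_derivative 0) (at t within {0..<T}))"
proof (rule exI[of _ 6], intro allI impI ballI)
  fix lam T t :: real and \<gamma> :: "real \<Rightarrow> real \<Rightarrow> real^2"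
  \<comment> \<open>Six is the order of the flow equation in \<open>x\<close>; it also covers the
    mixed second derivative used below.\<close>
  assume C6: "C_k_joint 6 T \<gamma>"
    and cr: "\<forall>t\<in>{0..<T}. closed_curve (\<gamma> t) \<and> regular_curve (\<gamma> t)"
    and flow: "\<forall>t\<in>{0..<T}. \<forall>x. d_t_perp T \<gamma> t x = flow_rhs lam (\<gamma> t) x"
    and t: "t \<in> {0..<T}"
  let ?I = "{0..<T}"
  have "C_k_joint (Suc (Suc 4)) T \<gamma>" using C6 by simp
  then obtain ft fx where
      ft: "\<And>t x. t \<in> ?I \<Longrightarrow> ((\<lambda>\<tau>. \<gamma> \<tau> x) has_vector_derivative ft t x) (at t within ?I)"
    and fx: "\<And>t x. t \<in> ?I \<Longrightarrow> (\<gamma> t has_vector_derivative fx t x) (at x)"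
    and Cft: "C_k_joint (Suc 4) T ft" and Cfx: "C_k_joint (Suc 4) T fx"
    and cont: "continuous_on (?I \<times> UNIV) (\<lambda>(t, x). \<gamma> t x)"
    unfolding C_k_joint.simps(2)[of "Suc 4"] by blast
  from Cfx obtain fxt where
      fxt: "\<And>t x. t \<in> ?I \<Longrightarrow> ((\<lambda>\<tau>. fx \<tau> x) has_vector_derivative fxt t x) (at t within ?I)"
    and Cfxt: "C_k_joint 4 T fxt"
    unfolding C_k_joint.simps by blast
  have C0: "C_k_joint k T f \<Longrightarrow> continuous_on (?I \<times> UNIV) (\<lambda>(t, x). f t x)" for k f
    by (cases k) auto
  note conts = cont C0[OF Cft] C0[OF Cfx] C0[OF Cfxt]
  have ftx: "(ft t has_vector_derivative fxt t x) (at x)" for x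
    using mixed_partials_commute[OF ft fx fxt C0[OF Cfxt] t] .

  have c: "closed_curve (\<gamma> t)" "regular_curve (\<gamma> t)" using cr t by auto
  have dx: "d_x (\<gamma> \<tau>) x = fx \<tau> x" if "\<tau> \<in> ?I" for \<tau> x
    using fx[OF that] by (rule vector_derivative_at)
  have dt: "d_t T \<gamma> t x = ft t x" for x
    unfolding d_t_def by (rule vector_derivative_within[OF at_within_time_ne_bot[OF t] ft[OF t]])
  \<comment> \<open>The curves \<open>\<gamma> \<tau> (x + 2 * pi)\<close> and
    \<open>\<gamma> \<tau> x\<close> coincide as functions of \<open>\<tau>\<close>, hence so do
    their time derivatives.\<close>
  have ft_periodic: "ft t (x + 2 * pi) = ft t x" for x
  proof (rule vector_derivative_unique_within[OF at_within_time_ne_bot[OF t]])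
    show "((\<lambda>\<tau>. \<gamma> \<tau> x) has_vector_derivative ft t (x + 2 * pi)) (at t within ?I)"
      using cr by (intro has_vector_derivative_transform[OF t _ ft[OF t]])
        (auto simp: closed_curve_def)
  qed (rule ft[OF t])

  obtain G where G: "\<And>x. (G has_vector_derivative
      (flow_rhs lam (\<gamma> t) x \<bullet> unit_normal (\<gamma> t) x) * norm (d_x (\<gamma> t) x)) (at x)"
    and G_periodic: "\<And>x. G (x + 2 * pi) = G x"
    using flow_rhs_normal_antiderivative[OF c C_k_joint_times_diff[OF C6 t]] by metis
  have G': "(G has_vector_derivative ft t x \<bullet> rot90 (fx t x)) (at x)" for x
  proof -
    \<comment> \<open>The flow equation fixes only the normal velocity, but the pairing with the
      normal sees nothing else.\<close>
    have "flow_rhs lam (\<gamma> t) x \<bullet> unit_normal (\<gamma> t) x = ft t x \<bullet> unit_normal (\<gamma> t) x"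
      using flow t by (metis d_t_perp_def P_perp_unit_normal dt)
    then show ?thesis
      using G[of x] unit_normal_speed[OF c(2), of x]
      by (simp add: dx[OF t] mult.commute flip: inner_scaleR_right)
  qed

  define g where "g = (\<lambda>\<tau> x. ft \<tau> x \<bullet> rot90 (fx \<tau> x) + \<gamma> \<tau> x \<bullet> rot90 (fxt \<tau> x))"
  \<comment> \<open>Here \<open>g\<close> is the time derivative of the area integrand. Moving the
    \<open>x\<close>-derivative off \<open>ft\<close> in its second term gives the boundary term,
    and by skewness of \<open>rot90\<close> a second copy of the first term; hence the factor 2 on
    \<open>G\<close>.\<close>
  define H where "H = (\<lambda>x. 2 * G x + \<gamma> t x \<bullet> rot90 (ft t x))"
  have "(H has_vector_derivative g t x) (at x)" for x
  proof -
    have "(H has_vector_derivative 2 * (ft t x \<bullet> rot90 (fx t x)) +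
        (\<gamma> t x \<bullet> rot90 (fxt t x) + fx t x \<bullet> rot90 (ft t x))) (at x)"
      unfolding H_def
      by (intro has_vector_derivative_add has_vector_derivative_mult_right G'
        bounded_bilinear.has_vector_derivative[OF bounded_bilinear_inner] fx[OF t]
        bounded_linear.has_vector_derivative[OF bounded_linear_rot90] ftx)
    then show ?thesis
      by (simp add: g_def inner_rot90_skew[of "fx t x"] inner_commute)
  qed
  then have "(g t has_integral H (2 * pi) - H 0) {0..2 * pi}"
    by (intro fundamental_theorem_of_calculus) (auto intro: has_vector_derivative_at_within)
  moreover have "H (2 * pi) = H 0"
    using G_periodic[of 0] ft_periodic[of 0] c(1)
    by (simp add: H_def closed_curve_def) (metis add_0)
  ultimately have int0: "integral {0..2 * pi} (g t) = 0"
    by (simp add: integral_unique)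

  have cont_rot: "continuous_on S (\<lambda>z. rot90 (h z))" if "continuous_on S h"
    for S :: "'a::topological_space set" and h
    using bounded_linear.continuous_on[OF bounded_linear_rot90 that] .
  have "((\<lambda>\<tau>. integral (cbox 0 (2 * pi)) (\<lambda>x. \<gamma> \<tau> x \<bullet> rot90 (fx \<tau> x)))
      has_real_derivative integral (cbox 0 (2 * pi)) (g t)) (at t within ?I)"
  proof (rule leibniz_rule_field_derivative)
    show "((\<lambda>\<tau>. \<gamma> \<tau> x \<bullet> rot90 (fx \<tau> x)) has_real_derivative g \<tau> x) (at \<tau> within ?I)"
      if "\<tau> \<in> ?I" for \<tau> x
      unfolding g_def has_real_derivative_iff_has_vector_derivative
      using bounded_bilinear.has_vector_derivative[OF bounded_bilinear_inner ft[OF that]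
        bounded_linear.has_vector_derivative[OF bounded_linear_rot90 fxt[OF that]]]
      by (simp add: add.commute)
    show "(\<lambda>x. \<gamma> \<tau> x \<bullet> rot90 (fx \<tau> x)) integrable_on cbox 0 (2 * pi)" if "\<tau> \<in> ?I" for \<tau>
      using continuous_on_slice[OF conts(1) that] continuous_on_slice[OF conts(3) that]
      by (intro integrable_continuous continuous_on_inner cont_rot)
    have "continuous_on (?I \<times> UNIV) (\<lambda>(\<tau>, x). g \<tau> x)"
      using conts unfolding g_def case_prod_beta
      by (intro continuous_on_add continuous_on_inner cont_rot)
    then show "continuous_on (?I \<times> cbox 0 (2 * pi)) (\<lambda>(\<tau>, x). g \<tau> x)"
      by (rule continuous_on_subset) auto
  qed (use t in auto)
  then have "((\<lambda>\<tau>. - (1/2) * integral {0..2 * pi} (\<lambda>x. \<gamma> \<tau> x \<bullet> rot90 (fx \<tau> x)))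
      has_real_derivative - (1/2) * 0) (at t within ?I)"
    using int0 by (intro DERIV_cmult) simp
  then show "((\<lambda>\<tau>. enclosed_area (\<gamma> \<tau>)) has_real_derivative 0) (at t within ?I)"
    unfolding mult_zero_right
    \<comment> \<open>Any positive radius works, since both functions agree at all times in the
      interval.\<close>
    by (rule has_field_derivative_transform_within[where d = 1])
      (use t cr dx in \<open>auto simp: enclosed_area_rot90\<close>)
qed

end
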